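(* Let $n,m,R$ be integers with $2\le n,m\le R$, let $V\in\mathbb{F}_q^{n\times R}$ and $W\in\mathbb{F}_q^{m\times R}$ be full-rank matrices and $C\le\mathbb{F}_q^R$ a linear code. Let $\mathcal{C}=\phi_{V,W}(C)$ be an $\mathbb{F}_q$-$[n\times m,k,d]$ code of tensor rank $R$, and suppose $\Delta^{\mathrm{trk}}(\mathcal{C})=0$. Then for every $c\in C$ of Hamming weight $d$: \begin{enumerate} \item $\dim(C_W*c)=\dim(C_V*c)=d$; \item $(C_W*c)\cap C_V^\perp=(C_V*c)\cap C_W^\perp=\{0\}$; \item $\dim\big(C_V\cap(C_W*c)^\perp\big)=n-d$; \item $\dim\big(C_W\cap(C_V*c)^\perp\big)=m-d$. \end{enumerate}
   Context: $\mathbb{F}_q$ is a finite field; $\phi_{V,W}(x)=V\,\mathrm{diag}(x)\,W^{\mathrm t}$ for $x\in\mathbb{F}_q^R$. $C_V,C_W$ are the codes spanned by the rows of $V,W$; $\perp$ is the dual w.r.t. the standard inner product; $v*w$ is the componentwise product and $C'*v=\{c*v:c\in C'\}$. An $\mathbb{F}_q$-$[n\times m,k,d]$ code is a $k$-dimensional subspace of $\mathbb{F}_q^{n\times m}$ with minimum rank $d$ of its nonzero elements. The tensor rank $\mathrm{trk}(\mathcal{C})$ is the minimum dimension of a subspace spanned by rank-one matrices containing $\mathcal{C}$, and $\Delta^{\mathrm{trk}}(\mathcal{C})=\mathrm{trk}(\mathcal{C})-(k+d-1)$. *)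

theory Defs
  imports "HOL-Analysis.Analysis"
begin

text \<open>Scalar multiplication on matrices (entrywise), making 'a^'m^'n an 'a-vector space.\<close>
definition mscale :: "'a::field \<Rightarrow> 'a^'m^'n \<Rightarrow> 'a^'m^'n" where
  "mscale c A = (\<chi> i j. c * A$i$j)"

interpretation mat: vector_space "mscale :: 'a::field \<Rightarrow> 'a^'m^'n \<Rightarrow> 'a^'m^'n"
  by unfold_locales (simp_all add: mscale_def vec_eq_iff algebra_simps)

text \<open>Diagonal matrix diag(x).\<close>
definition diagm :: "'a::zero^'r \<Rightarrow> 'a^'r^'r" where
  "diagm x = (\<chi> i j. if i = j then x$i else 0)"

text \<open>phi_{V,W}(x) = V diag(x) W^t.\<close>
definition phi :: "'a::field^'r^'n \<Rightarrow> 'a^'r^'m \<Rightarrow> 'a^'r \<Rightarrow> 'a^'m^'n" where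
  "phi V W x = V ** diagm x ** transpose W"

text \<open>Code spanned by the rows of a matrix.\<close>
definition row_code :: "'a::field^'r^'n \<Rightarrow> ('a^'r) set" where
  "row_code V = vec.span (rows V)"

text \<open>Dual code w.r.t. the standard inner product.\<close>
definition dual_code :: "('a::field^'r) set \<Rightarrow> ('a^'r) set" where
  "dual_code S = {y. \<forall>x\<in>S. (\<Sum>i\<in>UNIV. x$i * y$i) = 0}"

text \<open>C' * v = {c * v : c in C'} (componentwise product).\<close>
definition code_mult :: "('a::field^'r) set \<Rightarrow> 'a^'r \<Rightarrow> ('a^'r) set" where
  "code_mult S v = (\<lambda>c. c * v) ` S"

definition hamming_weight :: "'a::zero^'r \<Rightarrow> nat" where
  "hamming_weight x = card {i. x$i \<noteq> 0}"

text \<open>Minimum rank of the nonzero elements of a matrix code.\<close>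
definition min_rank :: "('a::field^'m^'n) set \<Rightarrow> nat" where
  "min_rank C = Min {rank A | A. A \<in> C \<and> A \<noteq> 0}"

text \<open>Tensor rank: minimum dimension of a subspace spanned by rank-one matrices containing C.\<close>
definition tensor_rank :: "('a::field^'m^'n) set \<Rightarrow> nat" where
  "tensor_rank C = (LEAST t. \<exists>S. (\<forall>A\<in>S. rank A = 1) \<and> C \<subseteq> mat.span S
                                  \<and> mat.dim (mat.span S) = t)"

text \<open>Delta^trk(C) = trk(C) - (k + d - 1), with k = dim C and d = min rank.\<close>
definition delta_trk :: "('a::field^'m^'n) set \<Rightarrow> int" where
  "delta_trk C = int (tensor_rank C) - (int (mat.dim C) + int (min_rank C) - 1)"

end

theory Submission
  imports Defs
begin

text \<open>Let d be the weight of c and D = diag(c), so rank D \<le> d and phi(c) = V D W^t has rank at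
  most d. Tensor rank R forces phi to be injective on C: a kernel vector x with x_j \<noteq> 0 allows
  one to clear coordinate j of every codeword without changing phi(C), which is then spanned by
  the R - 1 rank-one matrices phi(e_i), i \<noteq> j. Hence phi(c) is a nonzero codeword, and minimality
  of d gives rank(V N) = rank N = d for N = D W^t. Now C_W * c is the column space of N,
  the dual of C_V is ker V, and C_V \<inter> (C_W * c)^perp is the row space of V intersected with
  ker N^t, so rank-nullity yields the dimensions rank N - rank(V N) = 0 and
  rank V - rank(V N) = n - d. Transposing phi(c) exchanges the roles of V and W.\<close>

lemma matrix_vector_mult_axis_gen:
  fixes A :: "'a::comm_semiring_1^'n^'m"
  shows "A *v axis j 1 = column j A"
  by (simp add: vec_eq_iff column_def matrix_vector_mult_def axis_def if_distrib cong: if_cong)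

lemma span_columns_eq_range:
  fixes A :: "'a::field^'n^'m"
  shows "vec.span (columns A) = range ((*v) A)"
proof -
  have "columns A = (*v) A ` cart_basis"
    by (force simp: columns_def cart_basis_def matrix_vector_mult_axis_gen)
  then show ?thesis
    by (simp add: vec.span_image)
qed

lemma dim_columns_le_rank:
  fixes A :: "'a::field^'n^'m"
  shows "vec.dim (columns A) \<le> rank A"
proof -
  obtain B where B: "B \<subseteq> rows A" "vec.independent B" "rows A \<subseteq> vec.span B"
      "card B = vec.dim (rows A)"
    using vec.basis_exists by blast
  have fin: "finite B"
    using B(2) vec.finiteI_independent by blast
  have "\<exists>u. row i A = (\<Sum>b\<in>B. u b *s b)" for i
    using B(3) vec.span_finite[OF fin] by (auto simp: rows_def)
  then obtain L where L: "\<And>i. row i A = (\<Sum>b\<in>B. L i b *s b)"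
    by metis
  \<comment> \<open>The coefficient vectors of the rows w.r.t. B span the columns.\<close>
  define G where "G = (\<lambda>b. \<chi> i. L i b) ` B"
  have "columns A \<subseteq> vec.span G"
  proof
    fix x assume "x \<in> columns A"
    then obtain j where j: "x = column j A"
      by (auto simp: columns_def)
    have "x = (\<Sum>b\<in>B. b $ j *s (\<chi> i. L i b))"
      using arg_cong[where f = "\<lambda>v. v $ j", OF L]
      by (simp add: vec_eq_iff j column_def row_def sum_component mult.commute)
    also have "\<dots> \<in> vec.span G"
      by (intro vec.span_sum vec.span_scale vec.span_base) (auto simp: G_def)
    finally show "x \<in> vec.span G" .
  qed
  then have "vec.dim (columns A) \<le> card G"
    using vec.dim_le_card fin G_def by blast
  also have "\<dots> \<le> card B"
    unfolding G_def using card_image_le fin by blast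
  finally show ?thesis
    using B(4) by (simp add: row_rank_def_gen)
qed

lemma rank_transpose_gen:
  fixes A :: "'a::field^'n^'m"
  shows "rank (transpose A) = rank A"
  using dim_columns_le_rank[of A] dim_columns_le_rank[of "transpose A"]
  by (simp add: row_rank_def_gen)

lemma rank_dim_range_gen:
  fixes A :: "'a::field^'n^'m"
  shows "rank A = vec.dim (range ((*v) A))"
  by (metis rank_transpose_gen row_rank_def_gen rows_transpose span_columns_eq_range vec.dim_span)

lemma rank_mul_le_right_gen:
  fixes A :: "'a::field^'n^'m" and B :: "'a^'p^'n"
  shows "rank (A ** B) \<le> rank B"
proof -
  have "range ((*v) (A ** B)) = (*v) A ` range ((*v) B)"
    by (auto simp: image_comp o_def matrix_vector_mul_assoc)
  then show ?thesis
    by (simp add: rank_dim_range_gen vec.dim_image_le)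
qed

lemma rank_mul_le_left_gen:
  fixes A :: "'a::field^'n^'m" and B :: "'a^'p^'n"
  shows "rank (A ** B) \<le> rank A"
  by (metis matrix_transpose_mul rank_mul_le_right_gen rank_transpose_gen)

lemma rank_eq_0_gen:
  fixes A :: "'a::field^'n^'m"
  shows "rank A = 0 \<longleftrightarrow> A = 0"
  by (auto simp: rank_dim_range_gen matrix_eq)

context finite_dimensional_vector_space_pair_1
begin

lemma dim_image_add_dim_kernel:
  assumes lf: "Vector_Spaces.linear s1 s2 f" and U: "vs1.subspace U"
  shows "vs2.dim (f ` U) + vs1.dim {x\<in>U. f x = 0} = vs1.dim U"
proof -
  interpret lf: Vector_Spaces.linear s1 s2 f by fact
  define K where "K = {x\<in>U. f x = 0}"
  obtain B where B: "B \<subseteq> f ` U" "vs2.independent B" "f ` U \<subseteq> vs2.span B"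
      "card B = vs2.dim (f ` U)"
    using vs2.basis_exists by blast
  \<comment> \<open>U is the direct sum of the kernel and the span of preimages T of a basis of f ` U.\<close>
  have "\<forall>b\<in>B. \<exists>u. u \<in> U \<and> f u = b"
    using B(1) by blast
  then obtain g where g: "\<And>b. b \<in> B \<Longrightarrow> g b \<in> U" "\<And>b. b \<in> B \<Longrightarrow> f (g b) = b"
    by metis
  define T where "T = g ` B"
  have fT: "f ` T = B"
    unfolding T_def image_image using g(2) by simp
  have "inj_on f T"
    unfolding T_def inj_on_def using g(2) by auto
  then have inj: "inj_on f (vs1.span T)"
    using B(2) fT lf.inj_on_span_independent_image by blast
  have TU: "vs1.span T \<subseteq> U"
  proof (rule vs1.span_minimal)
    show "T \<subseteq> U"
      using g(1) by (auto simp: T_def)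
  qed (rule U)
  have "vs1.dim (vs1.span T) = card B"
    using dim_image_eq[OF lf, of T] inj B(2) fT by (simp add: vs2.dim_eq_card_independent)
  moreover have "vs1.span T \<inter> K = {0}"
  proof -
    have "x = 0" if "x \<in> vs1.span T" "f x = 0" for x
      using inj lf.inj_on_iff_eq_0[OF vs1.subspace_span] that by blast
    moreover have "0 \<in> K"
      using U by (simp add: K_def vs1.subspace_0)
    ultimately show ?thesis
      using vs1.span_zero by (auto simp: K_def)
  qed
  moreover have "{x + y |x y. x \<in> vs1.span T \<and> y \<in> K} = U"
  proof
    show "{x + y |x y. x \<in> vs1.span T \<and> y \<in> K} \<subseteq> U"
      using TU U by (auto simp: K_def vs1.subspace_add)
    show "U \<subseteq> {x + y |x y. x \<in> vs1.span T \<and> y \<in> K}"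
    proof
      fix u assume u: "u \<in> U"
      then have "f u \<in> f ` vs1.span T"
        using B(3) fT lf.span_image by blast
      then obtain t where t: "t \<in> vs1.span T" "f t = f u"
        by auto
      then have "u - t \<in> K"
        using u TU U by (auto simp: K_def vs1.subspace_diff lf.diff)
      then show "u \<in> {x + y |x y. x \<in> vs1.span T \<and> y \<in> K}"
        using t(1) by force
    qed
  qed
  moreover have "vs1.subspace K"
    using U lf.subspace_kernel by (simp add: K_def Collect_conj_eq vs1.subspace_inter)
  ultimately show ?thesis
    using vs1.dim_sums_Int[OF vs1.subspace_span, of K T] B(4) by (simp add: K_def)
qed

end

lemma dim_range_Int_kernel:
  fixes A :: "'a::field^'n^'m" and B :: "'a^'p^'n"
  shows "vec.dim (range ((*v) B) \<inter> {x. A *v x = 0}) = rank B - rank (A ** B)"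
proof -
  have "vec.dim ((*v) A ` range ((*v) B)) + vec.dim {x\<in>range ((*v) B). A *v x = 0}
      = vec.dim (range ((*v) B))"
    by (rule vec.dim_image_add_dim_kernel[OF matrix_vector_mul_linear_gen])
      (rule vec.subspace_image[OF vec.subspace_UNIV])
  moreover have "(*v) A ` range ((*v) B) = range ((*v) (A ** B))"
    by (auto simp: image_comp o_def matrix_vector_mul_assoc)
  moreover have "range ((*v) B) \<inter> {x. A *v x = 0} = {x\<in>range ((*v) B). A *v x = 0}"
    by blast
  ultimately show ?thesis
    by (simp add: rank_dim_range_gen)
qed

lemma row_code_eq_range:
  fixes V :: "'a::field^'r^'n"
  shows "row_code V = range ((*v) (transpose V))"
  using span_columns_eq_range[of "transpose V"] by (simp add: row_code_def)

lemma inner_matrix_vector_mult_transpose: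
  fixes N :: "'a::comm_semiring_1^'m^'r"
  shows "(\<Sum>i\<in>UNIV. (N *v y) $ i * x $ i) = (\<Sum>j\<in>UNIV. y $ j * (transpose N *v x) $ j)"
proof -
  have "(\<Sum>i\<in>UNIV. (N *v y) $ i * x $ i) = (\<Sum>i\<in>UNIV. \<Sum>j\<in>UNIV. y $ j * (N $ i $ j * x $ i))"
    by (simp add: matrix_vector_mult_def sum_distrib_left sum_distrib_right mult_ac)
  also have "\<dots> = (\<Sum>j\<in>UNIV. y $ j * (transpose N *v x) $ j)"
    by (subst sum.swap) (simp add: matrix_vector_mult_def transpose_def sum_distrib_left)
  finally show ?thesis .
qed

lemma dual_code_range:
  fixes N :: "'a::field^'m^'r"
  shows "dual_code (range ((*v) N)) = {x. transpose N *v x = 0}"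
proof (intro set_eqI iffI)
  fix x assume "x \<in> dual_code (range ((*v) N))"
  then have "(\<Sum>j\<in>UNIV. axis k 1 $ j * (transpose N *v x) $ j) = 0" for k
    by (simp add: dual_code_def inner_matrix_vector_mult_transpose)
  then show "x \<in> {x. transpose N *v x = 0}"
    by (simp add: vec_eq_iff axis_def if_distrib if_distribR cong: if_cong)
qed (simp add: dual_code_def inner_matrix_vector_mult_transpose)

lemma diagm_matrix_vector_mult:
  fixes c :: "'a::comm_semiring_1^'r"
  shows "diagm c *v z = z * c"
  by (simp add: vec_eq_iff matrix_vector_mult_def diagm_def if_distrib if_distribR mult.commute
      cong: if_cong)

lemma code_mult_range:
  fixes A :: "'a::field^'m^'r"
  shows "code_mult (range ((*v) A)) c = range ((*v) (diagm c ** A))"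
  by (auto simp: code_mult_def image_comp o_def diagm_matrix_vector_mult
      matrix_vector_mul_assoc[symmetric])

lemma phi_entry:
  "phi V W x $ k $ l = (\<Sum>i\<in>UNIV. V $ k $ i * x $ i * W $ l $ i)"
proof -
  have "(V ** diagm x) $ k $ i = V $ k $ i * x $ i" for i
    by (simp add: matrix_matrix_mult_def diagm_def if_distrib cong: if_cong)
  then show ?thesis
    by (simp add: phi_def matrix_matrix_mult_def[of "V ** diagm x"] transpose_def)
qed

lemma phi_eq_mult: "phi V W x = V ** (diagm x ** transpose W)"
  by (simp add: phi_def matrix_mul_assoc)

lemma transpose_phi: "transpose (phi V W x) = phi W V x"
  by (simp add: vec_eq_iff transpose_def phi_entry mult_ac)

lemma linear_phi: "Vector_Spaces.linear (*s) mscale (phi V W)"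
  by unfold_locales
    (simp_all add: vec_eq_iff phi_entry mscale_def algebra_simps sum.distrib sum_distrib_left)

lemma rank_phi_axis_le:
  fixes V :: "'a::field^'r^'n" and W :: "'a^'r^'m"
  shows "rank (phi V W (axis i 1)) \<le> 1"
proof -
  have "row k (phi V W (axis i 1)) = V $ k $ i *s column i W" for k
    by (simp add: vec_eq_iff row_def column_def phi_entry axis_def if_distrib if_distribR
        cong: if_cong)
  then have "rows (phi V W (axis i 1)) \<subseteq> vec.span {column i W}"
    by (auto simp: rows_def intro: vec.span_scale vec.span_base)
  then have "rank (phi V W (axis i 1)) \<le> card {column i W}"
    unfolding row_rank_def_gen by (rule vec.dim_le_card) simp
  then show ?thesis
    by simp
qed

lemma tensor_rank_phi_image_le:
  fixes V :: "'a::field^'r^'n" and W :: "'a^'r^'m"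
  assumes supp: "\<And>x i. x \<in> C \<Longrightarrow> i \<notin> I \<Longrightarrow> x $ i = 0"
  shows "tensor_rank (phi V W ` C) \<le> card I"
proof -
  interpret phi: Vector_Spaces.linear "(*s)" mscale "phi V W"
    by (rule linear_phi)
  define E where "E i = phi V W (axis i 1)" for i
  define S where "S = E ` {i\<in>I. E i \<noteq> 0}"
  have "rank A = 1" if A: "A \<in> S" for A
  proof -
    obtain i where "A = E i" "A \<noteq> 0"
      using A unfolding S_def by blast
    then show ?thesis
      using rank_phi_axis_le[of V W i] rank_eq_0_gen[of A] by (simp add: E_def)
  qed
  moreover have "phi V W ` C \<subseteq> mat.span S"
  proof
    fix A assume "A \<in> phi V W ` C"
    then obtain x where x: "x \<in> C" "A = phi V W x"
      by blast
    have "A = (\<Sum>i\<in>UNIV. mscale (x $ i) (E i))"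
      unfolding x(2) E_def by (subst basis_expansion[symmetric, of x]) (simp add: phi.sum phi.scale)
    also have "\<dots> \<in> mat.span S"
    proof (rule mat.span_sum)
      fix i
      show "mscale (x $ i) (E i) \<in> mat.span S"
      proof (cases "i \<in> I \<and> E i \<noteq> 0")
        case True
        then show ?thesis
          by (auto simp: S_def intro: mat.span_scale mat.span_base)
      next
        case False
        then have "mscale (x $ i) (E i) = 0"
          using supp[OF x(1)] by (auto simp: mscale_def vec_eq_iff)
        then show ?thesis
          by (simp only: mat.span_zero)
      qed
    qed
    finally show "A \<in> mat.span S" .
  qed
  moreover have "mat.dim (mat.span S) \<le> card I"
  proof -
    have "mat.dim (mat.span S) \<le> card S"
      by (rule mat.dim_le_card) (auto simp: S_def)
    also have "\<dots> \<le> card I"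
      unfolding S_def by (intro card_image_le[THEN order_trans] card_mono) auto
    finally show ?thesis .
  qed
  ultimately show ?thesis
    unfolding tensor_rank_def by (blast intro: Least_le[THEN order_trans])
qed

lemma tensor_rank_phi_image_less:
  fixes V :: "'a::field^'r^'n" and W :: "'a^'r^'m"
  assumes "x \<in> C" "x \<noteq> 0" "phi V W x = 0"
  shows "tensor_rank (phi V W ` C) < CARD('r)"
proof -
  interpret phi: Vector_Spaces.linear "(*s)" mscale "phi V W"
    by (rule linear_phi)
  obtain j where j: "x $ j \<noteq> 0"
    using assms(2) by (auto simp: vec_eq_iff)
  \<comment> \<open>Subtracting multiples of the kernel vector x clears coordinate j without changing the image.\<close>
  define clear where "clear y = y - (y $ j / x $ j) *s x" for y
  have "phi V W ` C = phi V W ` clear ` C"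
    using assms(3) by (simp add: image_image clear_def phi.diff phi.scale)
  also have "tensor_rank \<dots> \<le> card (UNIV - {j})"
    by (rule tensor_rank_phi_image_le) (use j in \<open>auto simp: clear_def\<close>)
  also have "\<dots> < CARD('r)"
    by (simp add: card_Diff_subset)
  finally show ?thesis .
qed

lemma min_rank_le:
  fixes C :: "('a::field^'m^'n) set"
  assumes "A \<in> C" "A \<noteq> 0"
  shows "min_rank C \<le> rank A"
proof -
  have "{rank A | A. A \<in> C \<and> A \<noteq> 0} \<subseteq> {..CARD('m)}"
    by (auto simp: row_rank_def_gen dim_subset_UNIV_cart_gen)
  then show ?thesis
    unfolding min_rank_def using assms by (blast intro: Min_le finite_subset)
qed

lemma rank_diagm_le:
  fixes c :: "'a::field^'r"
  shows "rank (diagm c) \<le> hamming_weight c"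
proof -
  define I where "I = {i. c $ i \<noteq> 0}"
  have "row i (diagm c) = c $ i *s axis i 1" for i
    by (simp add: vec_eq_iff row_def diagm_def axis_def)
  then have "row i (diagm c) \<in> vec.span ((\<lambda>i. axis i 1) ` I)" for i
    by (cases "c $ i = 0") (auto simp: I_def vec.span_zero intro: vec.span_scale vec.span_base)
  then have "rows (diagm c) \<subseteq> vec.span ((\<lambda>i. axis i 1) ` I)"
    by (auto simp: rows_def)
  then have "rank (diagm c) \<le> card ((\<lambda>i. axis i 1 :: 'a^'r) ` I)"
    unfolding row_rank_def_gen by (rule vec.dim_le_card) simp
  also have "\<dots> \<le> hamming_weight c"
    unfolding hamming_weight_def I_def by (rule card_image_le) simp
  finally show ?thesis .
qed

lemma rank_phi_le_hamming_weight:
  fixes V :: "'a::field^'r^'n" and W :: "'a^'r^'m"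
  shows "rank (phi V W c) \<le> hamming_weight c"
  using rank_mul_le_left_gen[of "V ** diagm c" "transpose W"] rank_mul_le_right_gen[of V "diagm c"]
    rank_diagm_le[of c]
  by (simp add: phi_def)

context
  fixes V :: "'a::field^'r^'n" and W :: "'a^'r^'m" and c :: "'a^'r"
  assumes rank_phi: "rank (phi V W c) = hamming_weight c"
begin

lemma rank_diagm_mult_transpose: "rank (diagm c ** transpose W) = hamming_weight c"
  using rank_mul_le_right_gen[of V "diagm c ** transpose W"]
    rank_mul_le_left_gen[of "diagm c" "transpose W"] rank_diagm_le[of c] rank_phi
  by (simp add: phi_eq_mult)

lemma code_mult_row_code_eq_range:
  "code_mult (row_code W) c = range ((*v) (diagm c ** transpose W))"
  unfolding row_code_eq_range by (rule code_mult_range)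

lemma dim_code_mult_row_code: "vec.dim (code_mult (row_code W) c) = hamming_weight c"
  using rank_diagm_mult_transpose by (simp add: code_mult_row_code_eq_range rank_dim_range_gen)

lemma code_mult_row_code_Int_dual_code:
  "code_mult (row_code W) c \<inter> dual_code (row_code V) = {0}"
proof -
  have "vec.dim (range ((*v) (diagm c ** transpose W)) \<inter> {x. V *v x = 0}) = 0"
    using dim_range_Int_kernel[where A = V and B = "diagm c ** transpose W"]
      rank_diagm_mult_transpose rank_phi
    by (simp add: phi_eq_mult)
  then have "range ((*v) (diagm c ** transpose W)) \<inter> {x. V *v x = 0} = {0}"
    by (auto intro!: range_eqI[where x = 0])
  then show ?thesis
    unfolding code_mult_row_code_eq_range unfolding row_code_eq_range dual_code_range
      transpose_transpose .
qed

lemma dim_row_code_Int_dual_code_mult: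
  "vec.dim (row_code V \<inter> dual_code (code_mult (row_code W) c)) = rank V - hamming_weight c"
proof -
  have "vec.dim (range ((*v) (transpose V))
      \<inter> {x. transpose (diagm c ** transpose W) *v x = 0}) = rank V - hamming_weight c"
    using dim_range_Int_kernel[where A = "transpose (diagm c ** transpose W)" and B = "transpose V"]
      rank_phi
    by (simp add: rank_transpose_gen matrix_transpose_mul[symmetric] phi_eq_mult
        del: transpose_matrix_vector)
  then show ?thesis
    unfolding code_mult_row_code_eq_range unfolding row_code_eq_range dual_code_range .
qed

end

theorem proposition3p11:
  fixes V :: "'a::{field,finite}^'r^'n"
    and W :: "'a^'r^'m"
    and C :: "('a^'r) set"
  assumes "2 \<le> CARD('n)" and "2 \<le> CARD('m)"
    and "CARD('n) \<le> CARD('r)" and "CARD('m) \<le> CARD('r)"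
    and "rank V = CARD('n)" and "rank W = CARD('m)"
    and "vec.subspace C"
    and "tensor_rank (phi V W ` C) = CARD('r)"
    and "delta_trk (phi V W ` C) = 0"
    and "c \<in> C" and "hamming_weight c = min_rank (phi V W ` C)"
  shows "vec.dim (code_mult (row_code W) c) = min_rank (phi V W ` C)
       \<and> vec.dim (code_mult (row_code V) c) = min_rank (phi V W ` C)
       \<and> code_mult (row_code W) c \<inter> dual_code (row_code V) = {0}
       \<and> code_mult (row_code V) c \<inter> dual_code (row_code W) = {0}
       \<and> vec.dim (row_code V \<inter> dual_code (code_mult (row_code W) c))
            = CARD('n) - min_rank (phi V W ` C)
       \<and> vec.dim (row_code W \<inter> dual_code (code_mult (row_code V) c))
            = CARD('m) - min_rank (phi V W ` C)"
proof -
  have rank_VW: "rank (phi V W c) = hamming_weight c"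
  proof (cases "c = 0")
    case True
    then show ?thesis
      by (simp add: vec_eq_iff phi_entry rank_eq_0_gen hamming_weight_def)
  next
    case False
    then have "phi V W c \<noteq> 0"
      using tensor_rank_phi_image_less assms(8,10) by fastforce
    then have "min_rank (phi V W ` C) \<le> rank (phi V W c)"
      using assms(10) by (blast intro: min_rank_le)
    then show ?thesis
      using rank_phi_le_hamming_weight[of V W c] assms(11) by linarith
  qed
  moreover have "rank (phi W V c) = hamming_weight c"
    using rank_VW by (metis transpose_phi rank_transpose_gen)
  ultimately show ?thesis
    using assms(5,6,11)
    by (simp add: dim_code_mult_row_code code_mult_row_code_Int_dual_code
        dim_row_code_Int_dual_code_mult)
qed

end
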